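(* Let $I$ be a closed interval, let $\Gamma$ be a finitely generated group of orientation-preserving $C^1$ diffeomorphisms of $I$, and let $\bar f\in\Gamma$ be nontrivial (that is, $\bar f\neq \mathrm{Id}$). Then there exists a constant $A>0$ such that, for infinitely many positive integers $n$, $$\|\bar f^n\|_{\Gamma}\ \geq\ A\log(n).$$
   Context: Here $I$ is compact and nondegenerate, and $\|\cdot\|_{\Gamma}$ denotes the word-length in $\Gamma$ with respect to a fixed finite generating system of $\Gamma$ (any two choices give bi-Lipschitz equivalent lengths). *)

theory Defs
  imports
    "HOL-Analysis.Analysis"
    "HOL-Algebra.Bij"
    "HOL-Algebra.Generated_Groups"
begin

(* Derivatives are taken within I, so they are one-sided at the end points of an interval
   and depend only on the values of f on I. *)
definition C1_on :: "real set \<Rightarrow> (real \<Rightarrow> real) \<Rightarrow> bool" where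
  "C1_on I f \<longleftrightarrow>
     (\<exists>f'. continuous_on I f' \<and>
           (\<forall>x\<in>I. (f has_real_derivative f' x) (at x within I)))"

(* Maps of I are represented as in BijGroup I: they are undefined outside I
   (Bij I is contained in extensional I), so HOL equality of maps is equality on I. *)
definition Diff1_plus :: "real set \<Rightarrow> (real \<Rightarrow> real) set" where
  "Diff1_plus I =
     {f \<in> Bij I. C1_on I f \<and> C1_on I (inv_into I f) \<and> strict_mono_on I f}"

(* Least number of factors from S and its inverses in a product equal to g;
   meaningful for g in generate G S. *)
definition word_length :: "('a, 'b) monoid_scheme \<Rightarrow> 'a set \<Rightarrow> 'a \<Rightarrow> nat" where
  "word_length G S g =
     (LEAST k. \<exists>ws. length ws = k \<and> set ws \<subseteq> S \<union> m_inv G ` S \<and>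
                    foldr (mult G) ws (one G) = g)"

end

theory Submission
  imports Defs
begin

text \<open>
  Pick \<open>x\<close> with \<open>f x \<noteq> x\<close>. The images under the powers \<open>f\<^sup>n\<close> of the interval between
  \<open>x\<close> and \<open>f x\<close> do not overlap, so for infinitely many \<open>n\<close> the image has length \<open>O(1/n)\<close>.
  A \<open>C\<^sup>1\<close> generator on a compact interval is bi-Lipschitz, say with constant \<open>L\<close>, so a word
  of length \<open>k\<close> shrinks lengths by at most the factor \<open>L\<^sup>k\<close>. Hence the word length \<open>k\<close> of
  \<open>f\<^sup>n\<close> satisfies \<open>n \<le> C L\<^sup>k\<close> for these \<open>n\<close>.
\<close>

section \<open>Words in a generating set of a group\<close>

context group
begin

lemma foldr_mult_closed:
  "set ws \<subseteq> carrier G \<Longrightarrow> foldr (\<otimes>) ws \<one> \<in> carrier G"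
  by (induction ws) auto

lemma foldr_mult_append:
  "set us \<subseteq> carrier G \<Longrightarrow> set vs \<subseteq> carrier G \<Longrightarrow>
     foldr (\<otimes>) (us @ vs) \<one> = foldr (\<otimes>) us \<one> \<otimes> foldr (\<otimes>) vs \<one>"
  by (induction us) (auto simp: m_assoc foldr_mult_closed)

lemma generate_imp_word:
  assumes "S \<subseteq> carrier G" and "g \<in> generate G S"
  shows "\<exists>ws. set ws \<subseteq> S \<union> m_inv G ` S \<and> foldr (\<otimes>) ws \<one> = g"
  using assms(2)
proof (induction rule: generate.induct)
  case one
  show ?case by (intro exI[of _ "[]"]) simp
next
  case (incl h)
  then show ?case using assms(1) by (intro exI[of _ "[h]"]) auto
next
  case (inv h)
  then show ?case using assms(1) by (intro exI[of _ "[inv h]"]) auto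
next
  case (eng h1 h2)
  then obtain us vs where
    "set us \<subseteq> S \<union> m_inv G ` S" "foldr (\<otimes>) us \<one> = h1"
    "set vs \<subseteq> S \<union> m_inv G ` S" "foldr (\<otimes>) vs \<one> = h2"
    by blast
  moreover have "S \<union> m_inv G ` S \<subseteq> carrier G"
    using assms(1) by auto
  ultimately have "set (us @ vs) \<subseteq> S \<union> m_inv G ` S"
    and "foldr (\<otimes>) (us @ vs) \<one> = h1 \<otimes> h2"
    using foldr_mult_append[of us vs] by auto
  then show ?case by blast
qed

text \<open>\<open>LEAST\<close> is meaningful only if some word represents \<open>g\<close>.
  Membership in \<open>generate G S\<close> supplies one, so a shortest word exists.\<close>

lemma word_length_attained:
  assumes "S \<subseteq> carrier G" and "g \<in> generate G S"
  obtains ws where "length ws = word_length G S g" "set ws \<subseteq> S \<union> m_inv G ` S"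
    "foldr (\<otimes>) ws \<one> = g"
proof -
  have "\<exists>k ws. length ws = k \<and> set ws \<subseteq> S \<union> m_inv G ` S \<and> foldr (\<otimes>) ws \<one> = g"
    using generate_imp_word[OF assms] by blast
  from LeastI_ex[OF this] show thesis
    unfolding word_length_def[symmetric] using that by blast
qed

end

section \<open>Bounds on the contraction of lengths by diffeomorphisms\<close>

lemma C1_on_imp_lipschitz:
  fixes a b :: real
  assumes "C1_on {a..b} g"
  obtains L where "L-lipschitz_on {a..b} g"
proof -
  obtain g' where cont: "continuous_on {a..b} g'"
    and deriv: "\<And>x. x \<in> {a..b} \<Longrightarrow> (g has_real_derivative g' x) (at x within {a..b})"
    using assms unfolding C1_on_def by blast
  have "bounded (g' ` {a..b})"
    using cont by (intro compact_imp_bounded compact_continuous_image) auto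
  then obtain C where C: "\<And>x. x \<in> {a..b} \<Longrightarrow> \<bar>g' x\<bar> \<le> C"
    unfolding bounded_iff by (metis image_eqI real_norm_def)
  have "\<bar>g x - g y\<bar> \<le> C * \<bar>x - y\<bar>" if "x \<in> {a..b}" "y \<in> {a..b}" for x y
    using field_differentiable_bound[of "{a..b}" g g' C x y] deriv C that by simp
  \<comment> \<open>For empty \<open>{a..b}\<close> the bound \<open>C\<close> may be negative, but
    a Lipschitz constant must be nonnegative; hence \<open>max 0 C\<close>.\<close>
  moreover have "C * \<bar>x - y\<bar> \<le> max 0 C * \<bar>x - y\<bar>" for x y
    by (intro mult_right_mono) auto
  ultimately have "(max 0 C)-lipschitz_on {a..b} g"
    by (intro lipschitz_onI) (unfold dist_real_def, meson order_trans, simp)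
  then show thesis by (rule that)
qed

text \<open>The inverse is also C1, hence Lipschitz; its Lipschitz inequality at \<open>g x\<close>
  and \<open>g y\<close> limits how much \<open>g\<close> can contract.\<close>

lemma Diff1_plus_expansion_bound:
  fixes a b :: real
  assumes "g \<in> Diff1_plus {a..b}"
  obtains L where "\<And>x y. x \<in> {a..b} \<Longrightarrow> y \<in> {a..b} \<Longrightarrow> \<bar>x - y\<bar> \<le> L * \<bar>g x - g y\<bar>"
proof -
  have bij: "bij_betw g {a..b} {a..b}" and "C1_on {a..b} (inv_into {a..b} g)"
    using assms by (auto simp: Diff1_plus_def Bij_def)
  then obtain L where L: "L-lipschitz_on {a..b} (inv_into {a..b} g)"
    using C1_on_imp_lipschitz by blast
  show thesis
  proof (rule that)
    fix x y assume x: "x \<in> {a..b}" and y: "y \<in> {a..b}"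
    show "\<bar>x - y\<bar> \<le> L * \<bar>g x - g y\<bar>"
      using lipschitz_onD[OF L, of "g x" "g y"] bij_betwE[OF bij] x y
        bij_betw_inv_into_left[OF bij]
      by (simp add: dist_real_def)
  qed
qed

lemma Diff1_plus_uniform_expansion_bound:
  fixes a b :: real
  assumes "finite T" and "T \<subseteq> Diff1_plus {a..b}"
  obtains L where "L > 1"
    "\<And>g x y. g \<in> T \<Longrightarrow> x \<in> {a..b} \<Longrightarrow> y \<in> {a..b} \<Longrightarrow> \<bar>x - y\<bar> \<le> L * \<bar>g x - g y\<bar>"
proof -
  have "\<forall>g\<in>T. \<exists>L. \<forall>x\<in>{a..b}. \<forall>y\<in>{a..b}. \<bar>x - y\<bar> \<le> L * \<bar>g x - g y\<bar>"
    using Diff1_plus_expansion_bound assms(2) by (meson subsetD)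
  then obtain L where
    L: "\<And>g x y. g \<in> T \<Longrightarrow> x \<in> {a..b} \<Longrightarrow> y \<in> {a..b} \<Longrightarrow> \<bar>x - y\<bar> \<le> L g * \<bar>g x - g y\<bar>"
    by metis
  \<comment> \<open>The inserted 2 covers the case of empty \<open>T\<close> and forces
    \<open>M > 1\<close>, so that \<open>ln M\<close> is positive.\<close>
  define M where "M = Max (insert 2 (L ` T))"
  have "M \<ge> 2" and "\<And>g. g \<in> T \<Longrightarrow> L g \<le> M"
    using assms(1) by (auto simp: M_def)
  show thesis
  proof (rule that)
    show "M > 1" using \<open>M \<ge> 2\<close> by simp
  next
    fix g x y assume "g \<in> T" "x \<in> {a..b}" "y \<in> {a..b}"
    then have "\<bar>x - y\<bar> \<le> L g * \<bar>g x - g y\<bar>" by (rule L)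
    also have "\<dots> \<le> M * \<bar>g x - g y\<bar>"
      using \<open>g \<in> T\<close> \<open>\<And>g. g \<in> T \<Longrightarrow> L g \<le> M\<close> by (intro mult_right_mono) auto
    finally show "\<bar>x - y\<bar> \<le> M * \<bar>g x - g y\<bar>" .
  qed
qed

lemma BijGroup_mult_apply:
  "g \<in> carrier (BijGroup I) \<Longrightarrow> h \<in> carrier (BijGroup I) \<Longrightarrow> x \<in> I \<Longrightarrow>
     (g \<otimes>\<^bsub>BijGroup I\<^esub> h) x = g (h x)"
  by (simp add: BijGroup_def compose_def)

lemma BijGroup_maps_to:
  "g \<in> carrier (BijGroup I) \<Longrightarrow> x \<in> I \<Longrightarrow> g x \<in> I"
  by (auto simp: BijGroup_def Bij_def dest: bij_betwE)

text \<open>Each letter costs one factor \<open>L\<close>. The head of the word is applied last, so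
  its bound is used at the images of \<open>x\<close> and \<open>y\<close> under the tail.\<close>

lemma word_expansion_bound:
  fixes I :: "real set"
  assumes "set ws \<subseteq> carrier (BijGroup I)" and "L \<ge> 0"
    and "\<And>g x y. g \<in> set ws \<Longrightarrow> x \<in> I \<Longrightarrow> y \<in> I \<Longrightarrow> \<bar>x - y\<bar> \<le> L * \<bar>g x - g y\<bar>"
    and "x \<in> I" and "y \<in> I"
  shows "\<bar>x - y\<bar> \<le> L ^ length ws *
    \<bar>foldr (mult (BijGroup I)) ws \<one>\<^bsub>BijGroup I\<^esub> x - foldr (mult (BijGroup I)) ws \<one>\<^bsub>BijGroup I\<^esub> y\<bar>"
  using assms(1,3)
proof (induction ws)
  case Nil
  then show ?case using assms(4,5) by (simp add: BijGroup_def)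
next
  case (Cons g ws)
  interpret group "BijGroup I" by (rule group_BijGroup)
  define h where "h = foldr (mult (BijGroup I)) ws \<one>\<^bsub>BijGroup I\<^esub>"
  have g: "g \<in> carrier (BijGroup I)" and h: "h \<in> carrier (BijGroup I)"
    using Cons.prems(1) by (auto simp: h_def intro: foldr_mult_closed)
  have "\<bar>x - y\<bar> \<le> L ^ length ws * \<bar>h x - h y\<bar>"
    unfolding h_def using Cons.prems by (intro Cons.IH) auto
  also have "\<dots> \<le> L ^ length ws * (L * \<bar>g (h x) - g (h y)\<bar>)"
    using Cons.prems(2)[of g "h x" "h y"] h assms(2,4,5)
    by (intro mult_left_mono) (auto simp: BijGroup_maps_to)
  finally show ?case
    using g h assms(4,5) by (simp add: BijGroup_mult_apply h_def[symmetric] mult_ac)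
qed

text \<open>By monotonicity the \<open>N\<close> step lengths telescope to at most
  \<open>b - a\<close>, so some step is at most their average. The window from \<open>N\<close> to
  \<open>2 * N\<close> keeps \<open>n\<close> comparable to \<open>N\<close>.\<close>

lemma monotone_bounded_small_step:
  fixes u :: "nat \<Rightarrow> real"
  assumes "monoseq u" and "\<And>n. u n \<in> {a..b}" and "N > 0"
  obtains n where "N \<le> n" "n < 2 * N" "\<bar>u (Suc n) - u n\<bar> \<le> (b - a) / N"
proof -
  have "(\<Sum>n=N..<2*N. \<bar>u (Suc n) - u n\<bar>) = \<bar>u (2 * N) - u N\<bar>"
    using assms(1) unfolding monoseq_iff
  proof
    assume inc: "incseq u"
    then have "(\<Sum>n=N..<2*N. \<bar>u (Suc n) - u n\<bar>) = (\<Sum>n=N..<2*N. u (Suc n) - u n)"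
      by (intro sum.cong) (auto simp: incseq_SucD)
    also have "\<dots> = u (2 * N) - u N" by (subst sum_Suc_diff') auto
    finally show ?thesis using incseqD[OF inc, of N "2 * N"] by simp
  next
    assume dec: "decseq u"
    then have "(\<Sum>n=N..<2*N. \<bar>u (Suc n) - u n\<bar>) = (\<Sum>n=N..<2*N. - (u (Suc n) - u n))"
      by (intro sum.cong) (auto simp: decseq_SucD)
    also have "\<dots> = - (u (2 * N) - u N)" by (subst sum_negf, subst sum_Suc_diff') auto
    finally show ?thesis using decseqD[OF dec, of N "2 * N"] by simp
  qed
  also have "\<dots> \<le> b - a"
    using assms(2)[of N] assms(2)[of "2 * N"] by (auto simp: abs_if)
  finally have total: "(\<Sum>n=N..<2*N. \<bar>u (Suc n) - u n\<bar>) \<le> b - a" .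
  have "\<exists>n\<in>{N..<2*N}. \<bar>u (Suc n) - u n\<bar> \<le> (b - a) / N"
  proof (rule ccontr)
    assume "\<not> ?thesis"
    then have "\<forall>n\<in>{N..<2*N}. (b - a) / N < \<bar>u (Suc n) - u n\<bar>"
      by (meson not_le)
    then have "(\<Sum>n=N..<2*N. (b - a) / N) < (\<Sum>n=N..<2*N. \<bar>u (Suc n) - u n\<bar>)"
      using \<open>N > 0\<close> by (intro sum_strict_mono) auto
    then show False using total \<open>N > 0\<close> by simp
  qed
  then show thesis using that by auto
qed

theorem mainTheorem3:
  fixes a b :: real and \<Gamma> S :: "(real \<Rightarrow> real) set" and f :: "real \<Rightarrow> real"
  assumes "a < b"
    and "subgroup \<Gamma> (BijGroup {a..b})"
    and "\<Gamma> \<subseteq> Diff1_plus {a..b}"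
    and "finite S" and "S \<subseteq> \<Gamma>" and "generate (BijGroup {a..b}) S = \<Gamma>"
    and "f \<in> \<Gamma>" and "f \<noteq> \<one>\<^bsub>BijGroup {a..b}\<^esub>"
  shows "\<exists>A::real. A > 0 \<and>
           infinite {n::nat. n > 0 \<and>
             real (word_length (BijGroup {a..b}) S (f [^]\<^bsub>BijGroup {a..b}\<^esub> n)) \<ge> A * ln (real n)}"
proof -
  let ?G = "BijGroup {a..b}"
  interpret group ?G by (rule group_BijGroup)
  interpret \<Gamma>: subgroup \<Gamma> ?G by (rule assms(2))
  have f: "f \<in> carrier ?G" using assms(7) by (rule \<Gamma>.mem_carrier)
  have pow: "f [^]\<^bsub>?G\<^esub> n \<in> \<Gamma>" for n :: nat
    using assms(7) by (induction n) (auto simp: \<Gamma>.m_closed)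
  \<comment> \<open>Elements of the group are extensional, so a map other than the unit moves a
    point of the interval.\<close>
  obtain x where x: "x \<in> {a..b}" "f x \<noteq> x"
  proof -
    have "f \<in> extensional {a..b}" using f by (auto simp: BijGroup_def Bij_def)
    then have "\<not> (\<forall>x\<in>{a..b}. f x = x)"
      using assms(8) by (auto simp: BijGroup_def intro!: extensionalityI[of f "{a..b}"])
    then show thesis using that by blast
  qed
  define D where "D = \<bar>f x - x\<bar>"
  have "D > 0" using x by (simp add: D_def)
  have fx: "f x \<in> {a..b}" using f x(1) by (rule BijGroup_maps_to)

  define u where "u n = (f [^]\<^bsub>?G\<^esub> n) x" for n :: nat
  have u_in: "u n \<in> {a..b}" for n
    unfolding u_def using \<Gamma>.mem_carrier[OF pow] x(1) by (rule BijGroup_maps_to)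
  \<comment> \<open>Splitting the power as \<open>f^n\<close> after \<open>f\<close> shows
    consecutive orbit points as the images of \<open>x\<close> and \<open>f x\<close> under the same
    map.\<close>
  have u_Suc: "u (Suc n) = (f [^]\<^bsub>?G\<^esub> n) (f x)" for n
    using \<Gamma>.mem_carrier[OF pow] f x(1) by (simp add: u_def BijGroup_mult_apply)
  have smono: "strict_mono_on {a..b} (f [^]\<^bsub>?G\<^esub> n)" for n :: nat
    using pow assms(3) by (auto simp: Diff1_plus_def)
  \<comment> \<open>Every power of \<open>f\<close> is increasing, so each orbit step has the sign
    of \<open>f x - x\<close>.\<close>
  have "monoseq u"
  proof (cases "x < f x")
    case True
    then have "u n \<le> u (Suc n)" for n
      using strict_mono_onD[OF smono x(1) fx, of n] by (simp add: u_Suc) (simp add: u_def)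
    then show ?thesis by (intro mono_SucI1) auto
  next
    case False
    then have "u (Suc n) \<le> u n" for n
      using strict_mono_onD[OF smono fx x(1), of n] x(2) by (simp add: u_Suc) (simp add: u_def)
    then show ?thesis by (intro mono_SucI2) auto
  qed

  \<comment> \<open>Words also use inverse letters. These lie in the subgroup
    \<open>\<Gamma>\<close> too, so one constant \<open>L\<close> serves all letters.\<close>
  define T where "T = S \<union> m_inv ?G ` S"
  have "T \<subseteq> \<Gamma>" using assms(5) by (auto simp: T_def)
  moreover have "finite T" using assms(4) by (simp add: T_def)
  ultimately obtain L where "L > 1" and
    L: "\<And>g x y. g \<in> T \<Longrightarrow> x \<in> {a..b} \<Longrightarrow> y \<in> {a..b} \<Longrightarrow> \<bar>x - y\<bar> \<le> L * \<bar>g x - g y\<bar>"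
    using Diff1_plus_uniform_expansion_bound assms(3) by (metis subset_trans)
  \<comment> \<open>A shortest word for the \<open>n\<close>-th power is applied to
    \<open>f x\<close> and \<open>x\<close>, whose distance \<open>D\<close> does not depend on
    \<open>n\<close>.\<close>
  have step: "D \<le> L ^ word_length ?G S (f [^]\<^bsub>?G\<^esub> n) * \<bar>u (Suc n) - u n\<bar>" for n
  proof -
    have "S \<subseteq> carrier ?G" using assms(5) \<Gamma>.subset by blast
    moreover have "f [^]\<^bsub>?G\<^esub> n \<in> generate ?G S" using pow assms(6) by simp
    ultimately obtain ws where ws: "length ws = word_length ?G S (f [^]\<^bsub>?G\<^esub> n)"
      "set ws \<subseteq> T" "foldr (mult ?G) ws \<one>\<^bsub>?G\<^esub> = f [^]\<^bsub>?G\<^esub> n"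
      unfolding T_def by (rule word_length_attained)
    have "set ws \<subseteq> carrier ?G" using ws(2) \<open>T \<subseteq> \<Gamma>\<close> \<Gamma>.subset by blast
    from word_expansion_bound[OF this, of L "f x" x] show ?thesis
      using ws L \<open>L > 1\<close> x(1) fx by (auto simp: D_def u_Suc) (auto simp: u_def)
  qed

  \<comment> \<open>These constants come from the estimate \<open>n \<le> L ^ k * C\<close> below,
    with \<open>k\<close> the word length. The maximum with 1 makes \<open>C\<close> visibly
    positive. The 2 in \<open>A\<close> pays for \<open>ln C\<close>, which is at most half of
    \<open>ln n\<close> once \<open>n\<close> is at least the square of \<open>C\<close>.\<close>
  define C where "C = max 1 (2 * (b - a) / D)"
  define A where "A = 1 / (2 * ln L)"
  have "A > 0" using \<open>L > 1\<close> by (simp add: A_def)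
  have "\<exists>n\<ge>m. n > 0 \<and> real (word_length ?G S (f [^]\<^bsub>?G\<^esub> n)) \<ge> A * ln (real n)" for m
  proof -
    \<comment> \<open>\<open>Suc m\<close> makes \<open>N\<close> positive and pushes
      \<open>n\<close> beyond \<open>m\<close>; the other term lets \<open>ln n\<close> absorb
      \<open>ln C\<close>.\<close>
    define N where "N = max (Suc m) (nat \<lceil>C\<^sup>2\<rceil>)"
    have "N > 0" by (simp add: N_def)
    then obtain n where n: "N \<le> n" "n < 2 * N" "\<bar>u (Suc n) - u n\<bar> \<le> (b - a) / N"
      using monotone_bounded_small_step[OF \<open>monoseq u\<close> u_in] by blast
    define k where "k = word_length ?G S (f [^]\<^bsub>?G\<^esub> n)"
    have "n > 0" using \<open>N > 0\<close> n(1) by simp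
    have "C\<^sup>2 \<le> real n"
      using n(1) by (simp add: N_def)
    have "D \<le> L ^ k * ((b - a) / N)"
      using order_trans[OF step mult_left_mono[OF n(3)]] \<open>L > 1\<close> by (simp add: k_def)
    \<comment> \<open>Here \<open>n < 2 * N\<close> turns the bound in \<open>1 / N\<close> into one
      in \<open>2 / n\<close>.\<close>
    also have "\<dots> \<le> L ^ k * (2 * (b - a) / n)"
    proof (intro mult_left_mono)
      have "(b - a) * real n \<le> (b - a) * (2 * real N)"
        using n(2) \<open>a < b\<close> by (intro mult_left_mono) auto
      then show "(b - a) / N \<le> 2 * (b - a) / n"
        using \<open>N > 0\<close> \<open>n > 0\<close> by (simp add: divide_simps mult_ac)
    qed (use \<open>L > 1\<close> in simp)
    finally have "real n \<le> L ^ k * (2 * (b - a) / D)"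
      using \<open>D > 0\<close> \<open>n > 0\<close> by (simp add: field_simps)
    also have "\<dots> \<le> L ^ k * C"
      using \<open>L > 1\<close> by (intro mult_left_mono) (auto simp: C_def)
    finally have "ln n \<le> ln (L ^ k * C)"
      using \<open>n > 0\<close> by simp
    also have "\<dots> = k * ln L + ln C"
      using \<open>L > 1\<close> by (simp add: ln_mult ln_realpow C_def)
    finally have "ln n \<le> k * ln L + ln C" .
    moreover have "2 * ln C \<le> ln n"
    proof -
      have "C > 0" by (simp add: C_def)
      then have "ln (C\<^sup>2) \<le> ln (real n)"
        using \<open>C\<^sup>2 \<le> real n\<close> \<open>n > 0\<close> by (subst ln_le_cancel_iff) auto
      then show ?thesis using \<open>C > 0\<close> by (simp add: ln_realpow)
    qed
    ultimately have "ln n \<le> 2 * (k * ln L)" by linarith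
    then have "A * ln (real n) \<le> real k"
      using \<open>L > 1\<close> by (simp add: A_def field_simps)
    moreover have "m \<le> n" using n(1) by (simp add: N_def)
    ultimately show ?thesis using \<open>n > 0\<close> k_def by blast
  qed
  then have "infinite {n. n > 0 \<and> real (word_length ?G S (f [^]\<^bsub>?G\<^esub> n)) \<ge> A * ln (real n)}"
    unfolding infinite_nat_iff_unbounded_le mem_Collect_eq by blast
  with \<open>A > 0\<close> show ?thesis by blast
qed

end
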